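(* Let $A \in \mathbb{C}^{m \times n}$, $W \in \mathbb{C}^{n \times m}$ be such that $\mathrm{ind}(A,W) \leq 1$ and $r(WAW)=r(A)$. Then the weighted core inverse of $A$ is the unique $\{1',2',3',{1^{1}}'\}$-inverse of $A$.
   Context: $r(\cdot)$ denotes rank, $\mathcal{R}(\cdot)$ range, $*$ conjugate transpose, $M^\dagger$ the Moore-Penrose inverse. The index $\mathrm{ind}(M)$ of a square matrix $M$ is the smallest non-negative integer $j$ with $r(M^j)=r(M^{j+1})$ (with $M^0=I$); $\mathrm{ind}(A,W)=\max\{\mathrm{ind}(AW),\mathrm{ind}(WA)\}$. For $\mathrm{ind}(A,W)\le 1$, the ($W$-)weighted core inverse of $A$ is the unique $X\in\mathbb{C}^{m\times n}$ with $WAWX=(WA)(WA)^{\dagger}$ and $\mathcal{R}(X)\subseteq\mathcal{R}(AW)$ (this is the weighted core-EP inverse, defined by $WAWX=(WA)^k[(WA)^k]^\dagger$, $\mathcal{R}(X)\subseteq\mathcal{R}((AW)^k)$, for $k=1$). A $\{1',2',3',{1^1}'\}$-inverse of $A$ is an $X\in\mathbb{C}^{m\times n}$ with $AWXWA=A$, $XWAWX=X$, $(WAWX)^*=WAWX$ and $XW(AW)^{2}=AW$. *)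

theory Defs
  imports "HOL-Analysis.Analysis"
begin

text \<open>
  A complex \<open>m \<times> n\<close> matrix is an element of \<^typ>\<open>complex^'n^'m\<close>.  The library function \<^const>\<open>rank\<close>,
  on matrices over an arbitrary field, is the dimension over that field (here \<open>\<complex>\<close>, not \<open>\<real>\<close>)
  of the row space.
\<close>

definition adj :: "complex^'n^'m \<Rightarrow> complex^'m^'n" where
  "adj M = map_matrix cnj (transpose M)"

definition mat_range :: "complex^'n^'m \<Rightarrow> (complex^'m) set" where
  "mat_range M = range (\<lambda>x. M *v x)"

primrec matpow :: "complex^'n^'n \<Rightarrow> nat \<Rightarrow> complex^'n^'n" where
  "matpow M 0 = mat 1"
| "matpow M (Suc j) = M ** matpow M j"

definition is_moore_penrose :: "complex^'n^'m \<Rightarrow> complex^'m^'n \<Rightarrow> bool" where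
  "is_moore_penrose M X \<longleftrightarrow>
     M ** X ** M = M \<and> X ** M ** X = X \<and> adj (M ** X) = M ** X \<and> adj (X ** M) = X ** M"

definition moore_penrose :: "complex^'n^'m \<Rightarrow> complex^'m^'n" where
  "moore_penrose M = (THE X. is_moore_penrose M X)"

definition mat_index :: "complex^'n^'n \<Rightarrow> nat" where
  "mat_index M = (LEAST j. rank (matpow M j) = rank (matpow M (Suc j)))"

definition weighted_index :: "complex^'n^'m \<Rightarrow> complex^'m^'n \<Rightarrow> nat" where
  "weighted_index A W = max (mat_index (A ** W)) (mat_index (W ** A))"

definition is_weighted_core_inverse ::
    "complex^'n^'m \<Rightarrow> complex^'m^'n \<Rightarrow> complex^'n^'m \<Rightarrow> bool" where
  "is_weighted_core_inverse A W X \<longleftrightarrow>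
     W ** A ** W ** X = (W ** A) ** moore_penrose (W ** A) \<and>
     mat_range X \<subseteq> mat_range (A ** W)"

text \<open>Meaningful for \<open>weighted_index A W \<le> 1\<close>; see \<open>ex1_weighted_core_inverse\<close> below.\<close>

definition weighted_core_inverse :: "complex^'n^'m \<Rightarrow> complex^'m^'n \<Rightarrow> complex^'n^'m" where
  "weighted_core_inverse A W = (THE X. is_weighted_core_inverse A W X)"

text \<open>The \<open>{1', 2', 3', 1\<^sup>1'}\<close>-inverses of \<open>A\<close> with respect to the weight \<open>W\<close>.\<close>

definition is_1231_inverse ::
    "complex^'n^'m \<Rightarrow> complex^'m^'n \<Rightarrow> complex^'n^'m \<Rightarrow> bool" where
  "is_1231_inverse A W X \<longleftrightarrow>
     A ** W ** X ** W ** A = A \<and>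
     X ** W ** A ** W ** X = X \<and>
     adj (W ** A ** W ** X) = W ** A ** W ** X \<and>
     X ** W ** matpow (A ** W) 2 = A ** W"


subsection \<open>The descriptions above determine their objects\<close>

lemma adj_adj [simp]: "adj (adj M) = M"
  by (simp add: adj_def transpose_def vec_eq_iff map_matrix_def)

lemma adj_mult: "adj (A ** B) = adj B ** adj A"
  by (simp add: adj_def transpose_def vec_eq_iff map_matrix_def matrix_matrix_mult_def mult.commute)

lemma inner_adj: "inner (A *v x) y = inner x (adj A *v y)"
  for A :: "complex^'n^'m"
proof -
  have "inner (A *v x) y = Re (\<Sum>i\<in>UNIV. \<Sum>j\<in>UNIV. A$i$j * x$j * cnj (y$i))"
    by (simp add: inner_vec_def matrix_vector_mult_def inner_complex_def sum_distrib_right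
        sum_distrib_left sum.distrib Re_sum Im_sum algebra_simps sum_subtractf)
  also have "\<dots> = Re (\<Sum>j\<in>UNIV. \<Sum>i\<in>UNIV. A$i$j * x$j * cnj (y$i))"
    by (subst sum.swap) simp
  also have "\<dots> = inner x (adj A *v y)"
    by (simp add: inner_vec_def matrix_vector_mult_def inner_complex_def adj_def transpose_def
        map_matrix_def sum_distrib_right sum_distrib_left sum.distrib Re_sum Im_sum algebra_simps sum_subtractf)
  finally show ?thesis .
qed

lemma normal_equation_vec: "\<exists>x. adj A *v (A *v x) = adj A *v y"
  for A :: "complex^'n^'m"
proof -
  have lin: "linear (\<lambda>x. A *v x)"
    by (rule linearI)
       (simp_all add: matrix_vector_mult_def vec_eq_iff scaleR_sum_right distrib_left sum.distrib)
  have S: "subspace (range (\<lambda>x. A *v x))"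
    using linear_subspace_image[OF lin subspace_UNIV] .
  obtain s z where s: "s \<in> span (range (\<lambda>x. A *v x))"
    and z: "\<And>w. w \<in> span (range (\<lambda>x. A *v x)) \<Longrightarrow> orthogonal z w" and y: "y = s + z"
    using orthogonal_subspace_decomp_exists[of "range (\<lambda>x. A *v x)" y] by metis
  obtain x where x: "s = A *v x" using s S by (auto simp: span_eq_iff[THEN iffD2])
  have "inner (adj A *v z) (adj A *v z) = inner (A *v (adj A *v z)) z"
    by (simp add: inner_adj)
  also have "\<dots> = 0"
    using z[of "A *v (adj A *v z)"] by (auto simp: orthogonal_def inner_commute intro: span_base)
  finally have "adj A *v z = 0" by simp
  then have "adj A *v y = adj A *v (A *v x)"
    by (simp add: y x matrix_vector_right_distrib)
  then show ?thesis by metis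
qed

lemma solve_columnwise:
  fixes A :: "complex^'n^'m" and B :: "complex^'k^'m"
  assumes "\<And>y. \<exists>x. A *v x = B *v y"
  shows "\<exists>C. B = A ** C"
proof -
  obtain f where f: "\<And>y. A *v f y = B *v y" using assms by metis
  define C :: "complex^'k^'n" where "C = (\<chi> i j. f (axis j 1) $ i)"
  have "(A ** C) $ i $ j = B $ i $ j" for i j
  proof -
    have "(A ** C) $ i $ j = (A *v f (axis j 1)) $ i"
      by (simp add: matrix_matrix_mult_def matrix_vector_mult_def C_def)
    also have "\<dots> = (B *v axis j 1) $ i" by (simp add: f)
    also have "\<dots> = B $ i $ j" by (simp add: matrix_vector_mult_def axis_def if_distrib[where f = "\<lambda>t. _ * t"] cong: if_cong)
    finally show ?thesis .
  qed
  then have "A ** C = B" by (simp add: vec_eq_iff)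
  then show ?thesis by metis
qed

lemma exists_13_inverse: "\<exists>B. A ** B ** A = A \<and> adj (A ** B) = A ** B"
  for A :: "complex^'n^'m"
proof -
  have "\<And>y. \<exists>x. (adj A ** A) *v x = adj A *v y"
    using normal_equation_vec by (simp add: matrix_vector_mul_assoc)
  from solve_columnwise[OF this] obtain B where "adj A = adj A ** A ** B" by auto
  then have e: "A = adj (A ** B) ** A"
    by (metis adj_adj adj_mult matrix_mul_assoc)
  then have "A ** B = adj (A ** B) ** (A ** B)" by (metis matrix_mul_assoc)
  then have h: "adj (A ** B) = A ** B" by (metis adj_adj adj_mult)
  with e show ?thesis by metis
qed

theorem ex1_moore_penrose: "\<exists>!X. is_moore_penrose M X"
proof (rule ex_ex1I)
  obtain B where B: "M ** B ** M = M" "adj (M ** B) = M ** B" using exists_13_inverse by blast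
  obtain C where C: "adj M ** C ** adj M = adj M" "adj (adj M ** C) = adj M ** C"
    using exists_13_inverse by blast
  define D where "D = adj C"
  have D: "M ** D ** M = M" "adj (D ** M) = D ** M"
    using arg_cong[OF C(1), of adj] C(2) by (simp_all add: D_def adj_mult matrix_mul_assoc)
  have 1: "M ** (D ** M ** B) = M ** B" and 2: "D ** M ** B ** M = D ** M"
    using B D by (metis matrix_mul_assoc)+
  have "is_moore_penrose M (D ** M ** B)"
    unfolding is_moore_penrose_def 1 2 using B D by (metis matrix_mul_assoc)
  then show "\<exists>X. is_moore_penrose M X" ..
next
  fix X Y assume "is_moore_penrose M X" "is_moore_penrose M Y"
  then have X: "M ** X ** M = M" "X ** M ** X = X" "adj (M ** X) = M ** X" "adj (X ** M) = X ** M"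
    and Y: "M ** Y ** M = M" "Y ** M ** Y = Y" "adj (M ** Y) = M ** Y" "adj (Y ** M) = Y ** M"
    by (simp_all add: is_moore_penrose_def)
  have "M ** X = (M ** Y) ** (M ** X)" using Y(1) by (metis matrix_mul_assoc)
  then have "M ** X = (M ** X) ** (M ** Y)" using X(3) Y(3) by (metis adj_mult)
  then have a: "M ** X = M ** Y" using X(1) by (metis matrix_mul_assoc)
  have "X ** M = (X ** M) ** (Y ** M)" using Y(1) by (metis matrix_mul_assoc)
  then have "X ** M = (Y ** M) ** (X ** M)" using X(4) Y(4) by (metis adj_mult)
  then have "X ** M = Y ** M" using X(1) by (metis matrix_mul_assoc)
  then show "X = Y" using a X(2) Y(2) by (metis matrix_mul_assoc)
qed

lemma rows_mult_subset: "rows (A ** B) \<subseteq> vec.span (rows B)"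
  for A :: "complex^'n^'m" and B :: "complex^'k^'n"
proof -
  have "row i (A ** B) = (\<Sum>j\<in>UNIV. (A$i$j) *s row j B)" for i
    by (simp add: vec_eq_iff row_def matrix_matrix_mult_def)
  moreover have "(\<Sum>j\<in>UNIV. (A$i$j) *s row j B) \<in> vec.span (rows B)" for i
    by (intro vec.span_sum vec.span_scale vec.span_base) (auto simp: rows_def)
  ultimately show ?thesis by (auto simp: rows_def)
qed

lemma rank_mult_le_right: "rank (A ** B) \<le> rank B"
  for A :: "complex^'n^'m" and B :: "complex^'k^'n"
  unfolding row_rank_def_gen by (rule vec.dim_mono[OF rows_mult_subset])

lemma mat_index_attained:
  "rank (matpow M (mat_index M)) = rank (matpow M (Suc (mat_index M)))"
proof -
  have "\<exists>j. rank (matpow M j) = rank (matpow M (Suc j))"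
  proof (rule ccontr)
    assume "\<nexists>j. rank (matpow M j) = rank (matpow M (Suc j))"
    then have less: "rank (matpow M (Suc j)) < rank (matpow M j)" for j
      using rank_mult_le_right[of M "matpow M j"] by (simp add: order.strict_iff_order) metis
    have "rank (matpow M j) + j \<le> rank (matpow M 0)" for j
    proof (induction j)
      case (Suc j) with less[of j] show ?case by linarith
    qed simp
    from this[of "Suc (rank (matpow M 0))"] show False by simp
  qed
  then show ?thesis unfolding mat_index_def by (rule LeastI_ex)
qed

lemma rank_eq_left_factor:
  fixes A :: "complex^'n^'m" and B :: "complex^'k^'n"
  assumes "rank (A ** B) = rank B" and "A ** B *v x = 0"
  shows "B *v x = 0"
proof -
  have sp: "vec.span (rows (A ** B)) = vec.span (rows B)"
    by (rule vec.subspace_dim_equal)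
       (use assms(1) vec.span_minimal[OF rows_mult_subset] in \<open>auto simp: row_rank_def_gen\<close>)
  define N where "N = {r :: complex^'k. (\<Sum>i\<in>UNIV. r$i * x$i) = 0}"
  have "vec.subspace N"
    by (auto simp: N_def vec.subspace_def distrib_right sum.distrib mult.assoc simp flip: sum_distrib_left)
  moreover have "rows (A ** B) \<subseteq> N"
    using assms(2) by (auto simp: N_def rows_def row_def matrix_vector_mult_def vec_eq_iff)
  ultimately have "vec.span (rows B) \<subseteq> N" unfolding sp[symmetric] by (rule vec.span_minimal[rotated])
  then have "row i B \<in> N" for i by (auto simp: rows_def intro: vec.span_base)
  then show ?thesis by (auto simp: N_def row_def matrix_vector_mult_def vec_eq_iff)
qed

lemma index_le_1_kernel:
  fixes M :: "complex^'n^'n"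
  assumes "mat_index M \<le> 1" "M ** M *v x = 0"
  shows "M *v x = 0"
proof (cases "mat_index M = 0")
  case True
  then have "rank (M ** mat 1) = rank (mat 1 :: complex^'n^'n)"
    using mat_index_attained[of M] by simp
  from rank_eq_left_factor[OF this, of "M *v x"] assms(2) show ?thesis
    by (simp add: matrix_vector_mul_assoc)
next
  case False
  with assms(1) have "mat_index M = 1" by simp
  then have "rank (M ** M) = rank M"
    using mat_index_attained[of M] by simp
  from rank_eq_left_factor[OF this assms(2)] show ?thesis .
qed

lemma index_le_1_factor:
  assumes "mat_index M \<le> 1"
  shows "\<exists>Z. M = M ** M ** Z"
proof (rule solve_columnwise)
  fix y
  let ?R = "range (\<lambda>x. M *v x)"
  have sub: "vec.subspace ?R"
    by (rule vec.subspace_image[OF vec.subspace_UNIV])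
  have "inj_on (\<lambda>x. M *v x) ?R"
  proof (rule inj_onI, clarify)
    fix a b assume "M *v (M *v a) = M *v (M *v b)"
    then have "M ** M *v (a - b) = 0"
      by (simp add: matrix_vector_mult_diff_distrib flip: matrix_vector_mul_assoc)
    from index_le_1_kernel[OF assms this] show "M *v a = M *v b"
      by (simp add: matrix_vector_mult_diff_distrib)
  qed
  then have "vec.dim ((\<lambda>x. M *v x) ` ?R) = vec.dim ?R"
    using sub by (intro vec.dim_image_eq) (auto simp: vec.span_eq_iff[THEN iffD2])
  then have "(\<lambda>x. M *v x) ` ?R = ?R"
    using sub by (intro vec.subspace_dim_equal vec.subspace_image) auto
  then have "M *v y \<in> (\<lambda>x. M *v x) ` ?R" by blast
  then show "\<exists>x. (M ** M) *v x = M *v y" by (auto simp: matrix_vector_mul_assoc)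
qed

theorem ex1_weighted_core_inverse:
  assumes "weighted_index A W \<le> 1"
  shows "\<exists>!X. is_weighted_core_inverse A W X"
proof (rule ex_ex1I)
  define B where "B = W ** A"
  define P where "P = moore_penrose B"
  have "mat_index B \<le> 1" using assms by (simp add: weighted_index_def B_def)
  from index_le_1_factor[OF this] obtain Z where Z: "B = B ** B ** Z" by blast
  define X where "X = A ** W ** (A ** Z ** Z ** P)"
  have "W ** A ** W ** X = B ** B ** B ** Z ** Z ** P"
    by (simp add: X_def B_def matrix_mul_assoc)
  also have "\<dots> = B ** (B ** B ** Z) ** Z ** P" by (simp add: matrix_mul_assoc)
  also have "\<dots> = B ** P" using Z by simp
  finally have "is_weighted_core_inverse A W X"
    by (auto simp: is_weighted_core_inverse_def B_def P_def mat_range_def X_def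
        simp flip: matrix_vector_mul_assoc)
  then show "\<exists>X. is_weighted_core_inverse A W X" ..
next
  fix X Y assume X: "is_weighted_core_inverse A W X" and Y: "is_weighted_core_inverse A W Y"
  have iAW: "mat_index (A ** W) \<le> 1" using assms by (simp add: weighted_index_def)
  have "X *v v = Y *v v" for v
  proof -
    obtain a b where ab: "X *v v = A ** W *v a" "Y *v v = A ** W *v b"
      using X Y unfolding is_weighted_core_inverse_def mat_range_def by blast
    have "W ** A ** W ** X = W ** A ** W ** Y"
      using X Y by (simp add: is_weighted_core_inverse_def)
    then have "(W ** A ** W ** X) *v v = (W ** A ** W ** Y) *v v" by simp
    then have "W *v (A *v (W *v (X *v v))) = W *v (A *v (W *v (Y *v v)))"
      by (simp flip: matrix_vector_mul_assoc)
    then have "A ** W ** (A ** W) *v (A ** W *v (a - b)) = 0"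
      by (simp add: ab matrix_vector_mult_diff_distrib flip: matrix_vector_mul_assoc)
    from index_le_1_kernel[OF iAW this] have "A ** W ** (A ** W) *v (a - b) = 0"
      by (simp flip: matrix_vector_mul_assoc)
    from index_le_1_kernel[OF iAW this] show ?thesis
      by (simp add: ab matrix_vector_mult_diff_distrib)
  qed
  then show "X = Y" by (simp add: matrix_eq)
qed

end

theory Submission
  imports Defs
begin

text \<open>
  Write \<open>M = WA\<close> and \<open>P = M M\<^sup>\<dagger>\<close>. The rank hypothesis lets \<open>W\<close> be cancelled on the left of
  \<open>A\<close>, and the index hypothesis makes \<open>AW\<close> injective on its own range. For the weighted core
  inverse, the identities reduce to \<open>P M = M\<close> and \<open>P P = P\<close> after these cancellations.
  Conversely, for a \<open>{1',2',3',1\<^sup>1'}\<close>-inverse \<open>X\<close> the matrix \<open>M W X\<close> is an orthogonal projection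
  with the same range as \<open>M\<close>, hence equals \<open>P\<close>; inserting \<open>AW = (AW)\<^sup>2 Z\<close> into \<open>X = X(WAWX)\<close>
  places the range of \<open>X\<close> inside that of \<open>AW\<close>.
\<close>

text \<open>The rows of the product are the images of the rows of \<open>A\<close> under the linear
  map \<open>transpose B\<close>, and a linear map does not raise dimension.\<close>

lemma rank_mult_le_left: "rank (A ** B) \<le> rank A"
  for A :: "complex^'n^'m" and B :: "complex^'k^'n"
proof -
  have "row i (A ** B) = transpose B *v row i A" for i
    by (simp add: vec_eq_iff row_def matrix_matrix_mult_def matrix_vector_mult_def
        transpose_def mult.commute)
  then have "rows (A ** B) = (\<lambda>r. transpose B *v r) ` rows A"
    by (auto simp: rows_def)
  then show ?thesis
    unfolding row_rank_def_gen
    by (simp only: vec.dim_image_le[OF matrix_vector_mul_linear_gen])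
qed

text \<open>\<open>L\<close> only has to be injective on the range of \<open>N\<close>, since the
  columns of \<open>N ** S - N ** T\<close> lie there. It serves for \<open>W\<close> in front of
  \<open>A\<close> and for \<open>A ** W\<close> in front of itself.\<close>

lemma mat_eq_left_cancel:
  fixes N :: "complex^'n^'m" and S T :: "complex^'k^'n" and L :: "complex^'m^'l"
  assumes ker: "\<And>x. L ** N *v x = 0 \<Longrightarrow> N *v x = 0"
    and eq: "L ** N ** S = L ** N ** T"
  shows "N ** S = N ** T"
proof -
  have "N ** S *v v = N ** T *v v" for v
  proof -
    have "L ** N *v (S *v v - T *v v) = 0"
      using eq by (simp add: matrix_vector_mult_diff_distrib matrix_vector_mul_assoc)
    from ker[OF this] show ?thesis
      by (simp add: matrix_vector_mult_diff_distrib matrix_vector_mul_assoc)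
  qed
  then show ?thesis by (simp add: matrix_eq)
qed

lemma mat_range_subset_iff: "mat_range X \<subseteq> mat_range Y \<longleftrightarrow> (\<exists>Q. X = Y ** Q)"
proof
  assume "mat_range X \<subseteq> mat_range Y"
  then have "\<exists>x. Y *v x = X *v y" for y
    unfolding mat_range_def by (metis (no_types, lifting) rangeE rangeI subsetD)
  then show "\<exists>Q. X = Y ** Q" by (rule solve_columnwise)
next
  assume "\<exists>Q. X = Y ** Q"
  then show "mat_range X \<subseteq> mat_range Y"
    by (auto simp: mat_range_def simp flip: matrix_vector_mul_assoc)
qed

lemma moore_penrose_is: "is_moore_penrose M (moore_penrose M)"
  unfolding moore_penrose_def by (rule theI'[OF ex1_moore_penrose])

text \<open>Taking adjoints in \<open>F ** E = E\<close> gives \<open>E ** F = E\<close>, while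
  \<open>E ** F = F\<close>.\<close>

lemma orthogonal_projection_unique:
  assumes "adj E = E" "adj F = F" "E ** F = F" "F ** E = E"
  shows "E = F"
  by (metis adj_mult assms)

lemma weighted_core_inverse_1231:
  fixes A :: "complex^'n^'m" and W :: "complex^'m^'n"
  assumes ind: "weighted_index A W \<le> 1" and rk: "rank (W ** A ** W) = rank A"
    and X: "is_weighted_core_inverse A W X"
  shows "is_1231_inverse A W X"
proof -
  define P where "P = W ** A ** moore_penrose (W ** A)"
  have PM: "P ** (W ** A) = W ** A" and Padj: "adj P = P"
    using moore_penrose_is[of "W ** A"] by (simp_all add: is_moore_penrose_def P_def)
  have PP: "P ** P = P"
    using PM by (simp add: P_def matrix_mul_assoc)
  have XP: "W ** A ** W ** X = P"
    using X by (simp add: is_weighted_core_inverse_def P_def)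
  obtain Q where Q: "X = A ** W ** Q"
    using X by (auto simp: is_weighted_core_inverse_def mat_range_subset_iff)
  \<comment> \<open>Sandwich: \<open>rank (W ** A ** W)\<close> \<le> \<open>rank (W ** A)\<close>
    \<le> \<open>rank A\<close>, with equal ends.\<close>
  have "rank (W ** A) = rank A"
    using rk rank_mult_le_left[of "W ** A" W] rank_mult_le_right[of W A] by simp
  note kerW = rank_eq_left_factor[OF this]
  have indAW: "mat_index (A ** W) \<le> 1" using ind by (simp add: weighted_index_def)
  have one: "A ** W ** X ** W ** A = A"
  proof -
    have "W ** A ** (W ** X ** W ** A) = W ** A ** mat 1"
      using PM by (simp add: matrix_mul_assoc XP)
    then have "A ** (W ** X ** W ** A) = A ** mat 1"
      by (rule mat_eq_left_cancel[rotated]) (rule kerW)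
    then show ?thesis by (simp add: matrix_mul_assoc)
  qed
  have two: "X ** W ** A ** W ** X = X"
  proof -
    \<comment> \<open>Uniqueness does the work: \<open>X ** P\<close> satisfies the same defining
      conditions as \<open>X\<close>, so \<open>X ** P = X\<close>.\<close>
    have "is_weighted_core_inverse A W (X ** P)"
      unfolding is_weighted_core_inverse_def mat_range_subset_iff
    proof
      show "W ** A ** W ** (X ** P) = W ** A ** moore_penrose (W ** A)"
        by (simp add: matrix_mul_assoc XP PP flip: P_def)
      show "\<exists>R. X ** P = A ** W ** R" by (metis Q matrix_mul_assoc)
    qed
    then have "X ** P = X" using ex1_weighted_core_inverse[OF ind] X by blast
    then show ?thesis by (simp add: matrix_mul_assoc flip: XP)
  qed
  have four: "X ** W ** (A ** W ** (A ** W)) = A ** W"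
  proof -
    \<comment> \<open>It remains to show \<open>A ** W ** R = A ** W\<close>. Multiplying by
      \<open>W ** A ** W\<close> on the left turns \<open>X\<close> into \<open>P\<close>, which
      \<open>W ** A\<close> absorbs. Then \<open>W\<close> is cancelled by the rank condition and
      one factor \<open>A ** W\<close> by the index condition.\<close>
    define R where "R = Q ** W ** (A ** W ** (A ** W))"
    have R: "X ** W ** (A ** W ** (A ** W)) = A ** W ** R"
      by (simp add: Q R_def matrix_mul_assoc)
    have "W ** A ** (W ** (A ** W ** R)) = P ** (W ** A) ** (W ** (A ** W))"
      by (simp add: matrix_mul_assoc XP flip: R)
    also have "\<dots> = W ** A ** (W ** (A ** W))" by (simp only: PM)
    finally have "A ** (W ** (A ** W ** R)) = A ** (W ** (A ** W))"
      by (rule mat_eq_left_cancel[rotated]) (rule kerW)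
    then have "A ** W ** (A ** W) ** R = A ** W ** (A ** W) ** mat 1"
      by (simp add: matrix_mul_assoc)
    then have "A ** W ** R = A ** W ** mat 1"
      by (rule mat_eq_left_cancel[rotated]) (rule index_le_1_kernel[OF indAW])
    with R show ?thesis by simp
  qed
  show ?thesis
    using one two four Padj
    by (simp add: is_1231_inverse_def XP numeral_2_eq_2)
qed

lemma weighted_core_inverse_if_1231:
  fixes A :: "complex^'n^'m" and W :: "complex^'m^'n"
  assumes ind: "weighted_index A W \<le> 1" and X: "is_1231_inverse A W X"
  shows "is_weighted_core_inverse A W X"
  unfolding is_weighted_core_inverse_def mat_range_subset_iff
proof
  let ?M = "W ** A"
  have one: "A ** W ** X ** W ** A = A" and two: "X ** W ** A ** W ** X = X"
    and three: "adj (W ** A ** W ** X) = W ** A ** W ** X"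
    and four: "X ** W ** (A ** W ** (A ** W)) = A ** W"
    using X by (simp_all add: is_1231_inverse_def numeral_2_eq_2)
  have EM: "W ** A ** W ** X ** ?M = ?M"
    using one by (metis matrix_mul_assoc)
  show "W ** A ** W ** X = ?M ** moore_penrose ?M"
  \<comment> \<open>Both matrices have \<open>?M\<close> as a left factor and both fix
    \<open>?M\<close> from the left, so each absorbs the other.\<close>
  proof (rule orthogonal_projection_unique[OF three])
    show "adj (?M ** moore_penrose ?M) = ?M ** moore_penrose ?M"
      using moore_penrose_is[of ?M] by (simp add: is_moore_penrose_def)
    show "W ** A ** W ** X ** (?M ** moore_penrose ?M) = ?M ** moore_penrose ?M"
      using EM by (simp add: matrix_mul_assoc)
    show "?M ** moore_penrose ?M ** (W ** A ** W ** X) = W ** A ** W ** X"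
      using moore_penrose_is[of ?M] by (simp add: is_moore_penrose_def matrix_mul_assoc)
  qed
  have "mat_index (A ** W) \<le> 1" using ind by (simp add: weighted_index_def)
  then obtain Z where Z: "A ** W = A ** W ** (A ** W) ** Z"
    using index_le_1_factor by blast
  \<comment> \<open>Chosen so that replacing \<open>A ** W\<close> by its square times
    \<open>Z\<close> in \<open>A = A ** W ** (X ** W ** A)\<close> yields \<open>A\<close> as that
    square times \<open>V\<close>, the shape needed for \<open>four\<close>.\<close>
  define V where "V = Z ** X ** W ** A"
  have "A = A ** W ** (A ** W) ** V"
    using one by (simp add: V_def matrix_mul_assoc flip: Z[unfolded matrix_mul_assoc])
  then have "X = X ** W ** (A ** W ** (A ** W) ** V) ** W ** X"
    using two by simp
  also have "\<dots> = X ** W ** (A ** W ** (A ** W)) ** (V ** W ** X)"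
    by (simp add: matrix_mul_assoc)
  also have "\<dots> = A ** W ** (V ** W ** X)" by (simp only: four)
  finally show "\<exists>Q. X = A ** W ** Q" ..
qed

theorem corollary3p1:
  fixes A :: "complex^'n^'m" and W :: "complex^'m^'n"
  assumes "weighted_index A W \<le> 1"
    and "rank (W ** A ** W) = rank A"
  shows "is_1231_inverse A W (weighted_core_inverse A W) \<and>
         (\<forall>X. is_1231_inverse A W X \<longrightarrow> X = weighted_core_inverse A W)"
proof -
  note ex1 = ex1_weighted_core_inverse[OF assms(1)]
  have core: "is_weighted_core_inverse A W (weighted_core_inverse A W)"
    unfolding weighted_core_inverse_def by (rule theI'[OF ex1])
  \<comment> \<open>Any other such inverse is again a weighted core inverse, of which there is only
    one.\<close>
  show ?thesis
    using weighted_core_inverse_1231[OF assms core] ex1 core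
      weighted_core_inverse_if_1231[OF assms(1)] by blast
qed

end
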